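(* The families of vectors which do norm retrieval in $\ell^2$ are not dense in the infinite families of vectors in $\ell^2$. That is, there exist a sequence $\{\phi_i\}_{i=1}^\infty$ of vectors in $\ell^2$ and an $\epsilon>0$ such that no sequence $\{\psi_i\}_{i=1}^\infty$ of vectors in $\ell^2$ with $\sum_{i=1}^\infty \|\phi_i-\psi_i\| < \epsilon$ does norm retrieval in $\ell^2$.
   Context: $\ell^2$ is the real Hilbert space of square-summable real sequences. A family $\{f_i\}_{i=1}^\infty$ in $\ell^2$ does norm retrieval if whenever $x,y\in\ell^2$ satisfy $|\langle x,f_i\rangle| = |\langle y,f_i\rangle|$ for all $i$, then $\|x\|=\|y\|$. Closeness of two sequences of vectors is measured by $\sum_{i=1}^\infty\|\phi_i-\psi_i\|$. *)

theory Defs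
  imports "HOL-Analysis.Analysis"
begin

lemma summable_square_mult:
  fixes f g :: "nat \<Rightarrow> real"
  assumes "summable (\<lambda>n. (f n)\<^sup>2)" "summable (\<lambda>n. (g n)\<^sup>2)"
  shows "summable (\<lambda>n. f n * g n)"
proof (rule summable_comparison_test')
  show "summable (\<lambda>n. (f n)\<^sup>2 + (g n)\<^sup>2)"
    using assms by (rule summable_add)
  show "norm (f n * g n) \<le> (f n)\<^sup>2 + (g n)\<^sup>2" for n
  proof -
    have "2 * (\<bar>f n\<bar> * \<bar>g n\<bar>) \<le> (f n)\<^sup>2 + (g n)\<^sup>2"
      using sum_squares_bound[of "\<bar>f n\<bar>" "\<bar>g n\<bar>"] by (simp add: mult.assoc)
    moreover have "0 \<le> \<bar>f n\<bar> * \<bar>g n\<bar>" by simp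
    ultimately have "\<bar>f n\<bar> * \<bar>g n\<bar> \<le> (f n)\<^sup>2 + (g n)\<^sup>2" by linarith
    then show ?thesis by (simp add: abs_mult)
  qed
qed

lemma summable_square_add:
  fixes f g :: "nat \<Rightarrow> real"
  assumes "summable (\<lambda>n. (f n)\<^sup>2)" "summable (\<lambda>n. (g n)\<^sup>2)"
  shows "summable (\<lambda>n. (f n + g n)\<^sup>2)"
proof -
  have "summable (\<lambda>n. (f n)\<^sup>2 + (g n)\<^sup>2 + 2 * (f n * g n))"
    by (intro summable_add summable_mult assms summable_square_mult)
  then show ?thesis by (simp add: power2_sum mult.assoc)
qed

typedef ell2 = "{f :: nat \<Rightarrow> real. summable (\<lambda>n. (f n)\<^sup>2)}"
  morphisms ell2_nth Abs_ell2
  by (rule exI[of _ "\<lambda>_. 0"]) simp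

setup_lifting type_definition_ell2

lemma ell2_eqI: "(\<And>n. ell2_nth x n = ell2_nth y n) \<Longrightarrow> x = y"
  by (simp add: ell2_nth_inject[symmetric] fun_eq_iff)

lemma summable_ell2_square: "summable (\<lambda>n. (ell2_nth x n)\<^sup>2)"
  using ell2_nth[of x] by simp

lemma summable_ell2_mult: "summable (\<lambda>n. ell2_nth x n * ell2_nth y n)"
  by (intro summable_square_mult summable_ell2_square)

instantiation ell2 :: real_vector
begin

lift_definition zero_ell2 :: ell2 is "\<lambda>_. 0" by simp

lift_definition plus_ell2 :: "ell2 \<Rightarrow> ell2 \<Rightarrow> ell2" is "\<lambda>f g n. f n + g n"
  by (rule summable_square_add)

lift_definition uminus_ell2 :: "ell2 \<Rightarrow> ell2" is "\<lambda>f n. - f n" by simp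

lift_definition minus_ell2 :: "ell2 \<Rightarrow> ell2 \<Rightarrow> ell2" is "\<lambda>f g n. f n - g n"
  using summable_square_add[of _ "\<lambda>n. - _ n"] by simp

lift_definition scaleR_ell2 :: "real \<Rightarrow> ell2 \<Rightarrow> ell2" is "\<lambda>c f n. c * f n"
  by (simp add: power_mult_distrib summable_mult)

instance
proof
  fix x y z :: ell2 and a b :: real
  show "x + y + z = x + (y + z)" by transfer (simp add: fun_eq_iff)
  show "x + y = y + x" by transfer (simp add: fun_eq_iff)
  show "0 + x = x" by transfer simp
  show "- x + x = 0" by transfer simp
  show "x - y = x + - y" by transfer simp
  show "a *\<^sub>R (x + y) = a *\<^sub>R x + a *\<^sub>R y" by transfer (simp add: algebra_simps)
  show "(a + b) *\<^sub>R x = a *\<^sub>R x + b *\<^sub>R x" by transfer (simp add: algebra_simps)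
  show "a *\<^sub>R b *\<^sub>R x = (a * b) *\<^sub>R x" by transfer (simp add: algebra_simps)
  show "1 *\<^sub>R x = x" by transfer simp
qed

end

instantiation ell2 :: real_inner
begin

definition inner_ell2 :: "ell2 \<Rightarrow> ell2 \<Rightarrow> real"
  where "inner_ell2 x y = (\<Sum>n. ell2_nth x n * ell2_nth y n)"

definition norm_ell2 :: "ell2 \<Rightarrow> real"
  where "norm_ell2 x = sqrt (x \<bullet> x)"

definition dist_ell2 :: "ell2 \<Rightarrow> ell2 \<Rightarrow> real"
  where "dist_ell2 x y = norm (x - y)"

definition sgn_ell2 :: "ell2 \<Rightarrow> ell2"
  where "sgn_ell2 x = x /\<^sub>R norm x"

definition uniformity_ell2 :: "(ell2 \<times> ell2) filter"
  where "uniformity_ell2 = (INF e\<in>{0<..}. principal {(x, y). dist x y < e})"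

definition open_ell2 :: "ell2 set \<Rightarrow> bool"
  where "open_ell2 U \<longleftrightarrow> (\<forall>x\<in>U. eventually (\<lambda>(x', y). x' = x \<longrightarrow> y \<in> U) uniformity)"

instance
proof
  fix x y z :: ell2 and a :: real and U :: "ell2 set"
  show "dist x y = norm (x - y)" by (rule dist_ell2_def)
  show "sgn x = x /\<^sub>R norm x" by (rule sgn_ell2_def)
  show "uniformity = (INF e\<in>{0<..}. principal {(x :: ell2, y). dist x y < e})"
    by (rule uniformity_ell2_def)
  show "open U \<longleftrightarrow> (\<forall>x\<in>U. eventually (\<lambda>(x', y). x' = x \<longrightarrow> y \<in> U) uniformity)"
    by (rule open_ell2_def)
  show "x \<bullet> y = y \<bullet> x" by (simp add: inner_ell2_def mult.commute)
  show "(x + y) \<bullet> z = x \<bullet> z + y \<bullet> z"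
    by (simp add: inner_ell2_def plus_ell2.rep_eq distrib_right suminf_add summable_ell2_mult)
  show "a *\<^sub>R x \<bullet> y = a * (x \<bullet> y)"
    by (simp add: inner_ell2_def scaleR_ell2.rep_eq mult.assoc suminf_mult summable_ell2_mult)
  show "0 \<le> x \<bullet> x"
    unfolding inner_ell2_def by (intro suminf_nonneg summable_ell2_mult) simp
  show "x \<bullet> x = 0 \<longleftrightarrow> x = 0"
  proof
    assume "x \<bullet> x = 0"
    then have "\<forall>n. ell2_nth x n * ell2_nth x n = 0"
      unfolding inner_ell2_def by (subst (asm) suminf_eq_zero_iff) (auto intro: summable_ell2_mult)
    then show "x = 0" by (intro ell2_eqI) (simp add: zero_ell2.rep_eq)
  qed (simp add: inner_ell2_def zero_ell2.rep_eq)
  show "norm x = sqrt (x \<bullet> x)" by (rule norm_ell2_def)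
qed

end

lemma ell2_nth_simps [simp]:
  "ell2_nth 0 n = 0"
  "ell2_nth (x + y) n = ell2_nth x n + ell2_nth y n"
  "ell2_nth (x - y) n = ell2_nth x n - ell2_nth y n"
  "ell2_nth (- x) n = - ell2_nth x n"
  "ell2_nth (c *\<^sub>R x) n = c * ell2_nth x n"
  by (simp_all add: zero_ell2.rep_eq plus_ell2.rep_eq minus_ell2.rep_eq uminus_ell2.rep_eq
      scaleR_ell2.rep_eq)

lemma norm_ell2_square: "(norm (x :: ell2))\<^sup>2 = (\<Sum>n. (ell2_nth x n)\<^sup>2)"
  unfolding power2_norm_eq_inner inner_ell2_def by (simp add: power2_eq_square)

lemma sum_ell2_le_norm: "(\<Sum>n<k. (ell2_nth x n)\<^sup>2) \<le> (norm x)\<^sup>2"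
  unfolding norm_ell2_square by (intro sum_le_suminf summable_ell2_square) auto

lemma abs_ell2_nth_le_norm: "\<bar>ell2_nth x n\<bar> \<le> norm x"
proof (rule power2_le_imp_le)
  have "(ell2_nth x n)\<^sup>2 \<le> (\<Sum>m<Suc n. (ell2_nth x m)\<^sup>2)"
    by (simp add: sum_nonneg)
  also have "\<dots> \<le> (norm x)\<^sup>2" by (rule sum_ell2_le_norm)
  finally show "\<bar>ell2_nth x n\<bar>\<^sup>2 \<le> (norm x)\<^sup>2" by simp
qed simp

instance ell2 :: complete_space
proof
  fix X :: "nat \<Rightarrow> ell2"
  assume X: "Cauchy X"
  have "Cauchy (\<lambda>k. ell2_nth (X k) n)" for n
  proof (rule metric_CauchyI)
    fix e :: real assume "e > 0"
    with X obtain N where N: "\<forall>m\<ge>N. \<forall>k\<ge>N. dist (X m) (X k) < e"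
      unfolding Cauchy_def by blast
    have "dist (ell2_nth (X m) n) (ell2_nth (X k) n) < e" if "m \<ge> N" "k \<ge> N" for m k
    proof -
      have "dist (ell2_nth (X m) n) (ell2_nth (X k) n) \<le> norm (X m - X k)"
        using abs_ell2_nth_le_norm[of "X m - X k" n] by (simp add: dist_real_def)
      also have "\<dots> < e" using N that by (simp add: dist_norm)
      finally show ?thesis .
    qed
    then show "\<exists>N. \<forall>m\<ge>N. \<forall>k\<ge>N. dist (ell2_nth (X m) n) (ell2_nth (X k) n) < e" by blast
  qed
  then have "\<exists>l. (\<lambda>k. ell2_nth (X k) n) \<longlonglongrightarrow> l" for n
    by (simp add: real_Cauchy_convergent convergentD)
  then obtain L where L: "\<And>n. (\<lambda>k. ell2_nth (X k) n) \<longlonglongrightarrow> L n" by metis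
  have tail: "\<exists>N. \<forall>m\<ge>N. \<forall>K. (\<Sum>n<K. (ell2_nth (X m) n - L n)\<^sup>2) \<le> e\<^sup>2" if "e > 0" for e :: real
  proof -
    from X that obtain N where N: "\<forall>m\<ge>N. \<forall>k\<ge>N. dist (X m) (X k) < e"
      unfolding Cauchy_def by blast
    have "(\<Sum>n<K. (ell2_nth (X m) n - L n)\<^sup>2) \<le> e\<^sup>2" if "m \<ge> N" for m K
    proof (rule LIMSEQ_le_const2)
      show "(\<lambda>k. \<Sum>n<K. (ell2_nth (X m) n - ell2_nth (X k) n)\<^sup>2)
              \<longlonglongrightarrow> (\<Sum>n<K. (ell2_nth (X m) n - L n)\<^sup>2)"
        by (intro tendsto_intros L)
      have "(\<Sum>n<K. (ell2_nth (X m) n - ell2_nth (X k) n)\<^sup>2) \<le> e\<^sup>2" if "k \<ge> N" for k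
      proof -
        have "(\<Sum>n<K. (ell2_nth (X m) n - ell2_nth (X k) n)\<^sup>2) \<le> (norm (X m - X k))\<^sup>2"
          using sum_ell2_le_norm[where x = "X m - X k" and k = K] by simp
        also have "\<dots> \<le> e\<^sup>2"
          using N[rule_format, OF \<open>m \<ge> N\<close> \<open>k \<ge> N\<close>] by (intro power_mono) (simp_all add: dist_norm)
        finally show ?thesis .
      qed
      then show "\<exists>N. \<forall>k\<ge>N. (\<Sum>n<K. (ell2_nth (X m) n - ell2_nth (X k) n)\<^sup>2) \<le> e\<^sup>2" by blast
    qed
    then show ?thesis by blast
  qed
  from tail[of 1] obtain M where M: "\<And>K. (\<Sum>n<K. (ell2_nth (X M) n - L n)\<^sup>2) \<le> 1" by auto
  have "summable (\<lambda>n. (ell2_nth (X M) n - L n)\<^sup>2)"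
    by (rule summableI_nonneg_bounded[OF _ M]) simp
  then have "summable (\<lambda>n. (- (ell2_nth (X M) n - L n))\<^sup>2)"
    by (simp only: power2_minus)
  from summable_square_add[OF this summable_ell2_square[of "X M"]]
  have "summable (\<lambda>n. (L n)\<^sup>2)" by simp
  then have nth_L: "ell2_nth (Abs_ell2 L) = L" by (simp add: Abs_ell2_inverse)
  have "X \<longlonglongrightarrow> Abs_ell2 L"
  proof (rule metric_LIMSEQ_I)
    fix r :: real assume r: "r > 0"
    then have "r / 2 > 0" by simp
    from tail[OF this] obtain N
      where N: "\<And>m K. m \<ge> N \<Longrightarrow> (\<Sum>n<K. (ell2_nth (X m) n - L n)\<^sup>2) \<le> (r / 2)\<^sup>2" by blast
    have "dist (X m) (Abs_ell2 L) < r" if "m \<ge> N" for m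
    proof -
      have "(norm (X m - Abs_ell2 L))\<^sup>2 \<le> (r / 2)\<^sup>2"
        unfolding norm_ell2_square
      proof (rule suminf_le_const[OF summable_ell2_square])
        show "(\<Sum>n<K. (ell2_nth (X m - Abs_ell2 L) n)\<^sup>2) \<le> (r / 2)\<^sup>2" for K
          using N[OF that, of K] by (simp only: ell2_nth_simps nth_L)
      qed
      then have "norm (X m - Abs_ell2 L) \<le> r / 2"
        by (rule power2_le_imp_le) (use r in simp)
      then show ?thesis using r by (simp add: dist_norm)
    qed
    then show "\<exists>N. \<forall>m\<ge>N. dist (X m) (Abs_ell2 L) < r" by blast
  qed
  then show "convergent X" by (rule convergentI)
qed

instance ell2 :: banach ..

definition norm_retrieval :: "(nat \<Rightarrow> 'a :: real_inner) \<Rightarrow> bool"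
  where "norm_retrieval f \<longleftrightarrow>
    (\<forall>x y. (\<forall>i. \<bar>x \<bullet> f i\<bar> = \<bar>y \<bullet> f i\<bar>) \<longrightarrow> norm x = norm y)"

end

theory Submission
  imports Defs
begin

text \<open>
  Norm retrieval fails for \<open>\<psi>\<close> as soon as there are non-orthogonal \<open>u\<close>, \<open>v\<close> such that every
  \<open>\<psi> i\<close> is orthogonal to one of them: take \<open>x = u + v\<close> and \<open>y = u - v\<close>. Members of a biorthogonal
  system have this property when they are not orthogonal to each other, so a non-orthogonal Riesz
  basis such as \<open>e\<^sub>0, e\<^sub>0 + e\<^sub>1, e\<^sub>2, e\<^sub>3, \<dots>\<close> fails norm retrieval. The biorthogonal system moves
  little under small \<open>\<ell>\<^sup>1\<close> perturbations, by a Neumann-series argument, so the failure is stable.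
\<close>

lemma not_norm_retrieval:
  fixes u v :: "'a :: real_inner"
  assumes orth: "\<And>i. u \<bullet> f i = 0 \<or> v \<bullet> f i = 0" and uv: "u \<bullet> v \<noteq> 0"
  shows "\<not> norm_retrieval f"
proof
  assume "norm_retrieval f"
  moreover have "\<bar>(u + v) \<bullet> f i\<bar> = \<bar>(u - v) \<bullet> f i\<bar>" for i
    using orth[of i] by (auto simp: inner_add_left inner_diff_left)
  ultimately have "norm (u + v) = norm (u - v)"
    unfolding norm_retrieval_def by blast
  then have "(norm (u + v))\<^sup>2 = (norm (u - v))\<^sup>2" by simp
  then show False
    using uv by (simp add: power2_norm_eq_inner algebra_simps inner_commute)
qed

text \<open>With \<open>d = \<phi> - \<psi>\<close>, the condition on \<open>u\<close> reads
  \<open>u \<bullet> \<phi> j = w \<bullet> \<phi> j + u \<bullet> d j\<close>. By biorthogonality,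
  any solution of \<open>u = w + T u\<close> satisfies it, where \<open>T\<close> sends
  \<open>x\<close> to the sum of the \<open>(x \<bullet> d i) *\<^sub>R g i\<close>.\<close>

lemma biorthogonal_perturbation:
  fixes \<phi> \<psi> g :: "nat \<Rightarrow> 'a :: {real_inner, banach}" and w :: 'a
  assumes bi: "\<And>i j. g i \<bullet> \<phi> j = (if i = j then 1 else 0)"
    and g: "\<And>i. norm (g i) \<le> M"
    and sm: "summable (\<lambda>i. norm (\<phi> i - \<psi> i))"
    and q: "M * (\<Sum>i. norm (\<phi> i - \<psi> i)) \<le> q" "q < 1"
  obtains u where "\<And>j. u \<bullet> \<psi> j = w \<bullet> \<phi> j" and "norm (u - w) \<le> q * norm u"
proof -
  define d where "d i = \<phi> i - \<psi> i" for i
  define T where "T x = (\<Sum>i. (x \<bullet> d i) *\<^sub>R g i)" for x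
  have M: "0 \<le> M" using order_trans[OF norm_ge_zero g[of 0]] .
  have bd: "norm ((x \<bullet> d i) *\<^sub>R g i) \<le> (M * norm x) * norm (d i)" for x i
    using mult_mono[OF Cauchy_Schwarz_ineq2[of x "d i"] g[of i]] by (simp add: mult_ac)
  have smd: "summable (\<lambda>i. norm (d i))" using sm by (simp add: d_def)
  have smT: "summable (\<lambda>i. (x \<bullet> d i) *\<^sub>R g i)" for x
    by (rule summable_comparison_test'[OF summable_mult[OF smd] bd])
  have normT: "norm (T x) \<le> q * norm x" for x
  proof -
    have "norm (T x) \<le> (\<Sum>i. (M * norm x) * norm (d i))"
      unfolding T_def by (rule norm_suminf_le[OF bd summable_mult[OF smd]])
    also have "\<dots> = (M * (\<Sum>i. norm (d i))) * norm x"
      by (subst suminf_mult[OF smd]) (simp add: mult_ac)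
    also have "\<dots> \<le> q * norm x"
      using q by (intro mult_right_mono) (simp_all add: d_def)
    finally show ?thesis .
  qed
  have q0: "0 \<le> q"
    using q(1) mult_nonneg_nonneg[OF M suminf_nonneg[OF sm norm_ge_zero]] by linarith
  have diffT: "T x - T y = T (x - y)" for x y
    unfolding T_def by (simp add: suminf_diff[OF smT smT] inner_diff_left scaleR_left_diff_distrib)
  \<comment> \<open>By \<open>diffT\<close> and \<open>normT\<close> the map is a
    \<open>q\<close>-contraction; its fixed point is the sum of the Neumann series of the
    \<open>T^n w\<close>.\<close>
  have "\<exists>!u. w + T u = u"
    using normT by (intro banach_fix_type[OF q0 q(2)]) (simp add: dist_norm diffT)
  then obtain u where u: "w + T u = u" by blast
  show thesis
  proof
    have "T u \<bullet> \<phi> j = u \<bullet> d j" for j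
    proof -
      have "T u \<bullet> \<phi> j = (\<Sum>i. ((u \<bullet> d i) *\<^sub>R g i) \<bullet> \<phi> j)"
        unfolding T_def by (rule bounded_linear.suminf[OF bounded_linear_inner_left smT])
      also have "\<dots> = (\<Sum>i. if i = j then u \<bullet> d i else 0)"
        by (rule arg_cong[of _ _ suminf]) (auto simp: bi)
      also have "\<dots> = u \<bullet> d j"
        using sums_single[of j "\<lambda>i. u \<bullet> d i"] by (simp add: sums_iff)
      finally show ?thesis .
    qed
    then have "u \<bullet> \<phi> j = w \<bullet> \<phi> j + u \<bullet> d j" for j
      using u by (metis inner_add_left)
    then show "u \<bullet> \<psi> j = w \<bullet> \<phi> j" for j
      by (simp add: d_def inner_diff_right)
    have "u - w = T u" using u by (metis add_diff_cancel_left')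
    then show "norm (u - w) \<le> q * norm u" using normT[of u] by simp
  qed
qed

definition ell2_unit :: "nat \<Rightarrow> ell2"
  where "ell2_unit n = Abs_ell2 (\<lambda>m. if m = n then 1 else 0)"

lemma ell2_nth_unit: "ell2_nth (ell2_unit n) m = (if m = n then 1 else 0)"
proof -
  have "summable (\<lambda>m. (if m = n then 1 else 0 :: real)\<^sup>2)"
    by (rule summable_finite[of "{n}"]) auto
  then show ?thesis by (simp add: ell2_unit_def Abs_ell2_inverse)
qed

lemma inner_ell2_unit: "ell2_unit n \<bullet> x = ell2_nth x n"
proof -
  have "(\<lambda>m. ell2_nth (ell2_unit n) m * ell2_nth x m) = (\<lambda>m. if m = n then ell2_nth x m else 0)"
    by (auto simp: ell2_nth_unit)
  then show ?thesis
    using sums_single[of n "ell2_nth x"] by (simp add: inner_ell2_def sums_iff)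
qed

lemma norm_ell2_unit: "norm (ell2_unit n) = 1"
  by (simp add: norm_eq_sqrt_inner inner_ell2_unit ell2_nth_unit)

theorem theorem17:
  shows "\<exists>(\<phi> :: nat \<Rightarrow> ell2) (\<epsilon> :: real). \<epsilon> > 0 \<and>
    (\<forall>\<psi> :: nat \<Rightarrow> ell2.
      summable (\<lambda>i. norm (\<phi> i - \<psi> i)) \<and> (\<Sum>i. norm (\<phi> i - \<psi> i)) < \<epsilon> \<longrightarrow>
      \<not> norm_retrieval \<psi>)"
proof -
  \<comment> \<open>Shearing only the first two coordinates makes the dual vectors
    \<open>g 0\<close> and \<open>g 1\<close> non-orthogonal, with inner product -1.\<close>
  define \<phi> where "\<phi> i = (if i = 1 then ell2_unit 0 + ell2_unit 1 else ell2_unit i)" for i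
  define g where "g i = (if i = 0 then ell2_unit 0 - ell2_unit 1 else ell2_unit i)" for i
  have bi: "g i \<bullet> \<phi> j = (if i = j then 1 else 0)" for i j
    by (auto simp: g_def \<phi>_def inner_diff_left inner_ell2_unit ell2_nth_unit)
  have g2: "norm (g i) \<le> 2" for i
    using norm_triangle_ineq4[of "ell2_unit 0" "ell2_unit 1"] by (auto simp: g_def norm_ell2_unit)
  have "\<not> norm_retrieval \<psi>"
    \<comment> \<open>With the bound 2 on the norms of the \<open>g i\<close>, the radius 1/20 gives
      the contraction constant 1/10.\<close>
    if sm: "summable (\<lambda>i. norm (\<phi> i - \<psi> i))" and lt: "(\<Sum>i. norm (\<phi> i - \<psi> i)) < 1 / 20" for \<psi>
  proof -
    have q: "2 * (\<Sum>i. norm (\<phi> i - \<psi> i)) \<le> 1 / 10" using lt by simp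
    obtain u where u: "\<And>j. u \<bullet> \<psi> j = g 0 \<bullet> \<phi> j" "norm (u - g 0) \<le> 1 / 10 * norm u"
      using biorthogonal_perturbation[OF bi g2 sm q, of "g 0"] by auto
    obtain v where v: "\<And>j. v \<bullet> \<psi> j = g 1 \<bullet> \<phi> j" "norm (v - g 1) \<le> 1 / 10 * norm v"
      using biorthogonal_perturbation[OF bi g2 sm q, of "g 1"] by auto
    have g1: "norm (g 1) = 1" by (simp add: g_def norm_ell2_unit)
    \<comment> \<open>Absorb the relative error: \<open>norm v\<close> is at most
      \<open>1 + norm v / 10\<close>.\<close>
    have "norm v \<le> 10 / 9" "norm (v - g 1) \<le> 1 / 9"
      using v(2) norm_triangle_sub[of v "g 1"] g1 by auto
    moreover have "norm (u - g 0) \<le> 2 / 9"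
      using u(2) norm_triangle_sub[of u "g 0"] g2[of 0] by auto
    ultimately have "\<bar>(u - g 0) \<bullet> v\<bar> \<le> 2 / 9 * (10 / 9)" "\<bar>g 0 \<bullet> (v - g 1)\<bar> \<le> 2 * (1 / 9)"
      using g2[of 0] by (meson Cauchy_Schwarz_ineq2 mult_mono' norm_ge_zero order_trans)+
    \<comment> \<open>The two error terms total at most 20/81 + 18/81 < 1, too little to cancel the
      main term -1.\<close>
    moreover have "u \<bullet> v = g 0 \<bullet> g 1 + (u - g 0) \<bullet> v + g 0 \<bullet> (v - g 1)"
      by (simp add: inner_diff_left inner_diff_right)
    moreover have "g 0 \<bullet> g 1 = -1"
      by (simp add: g_def inner_diff_left inner_ell2_unit ell2_nth_unit)
    ultimately have "u \<bullet> v \<noteq> 0" by linarith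
    \<comment> \<open>\<open>u\<close> is orthogonal to every \<open>\<psi> j\<close> except
      \<open>j = 0\<close>, and \<open>v\<close> to every one except \<open>j = 1\<close>.\<close>
    then show ?thesis
      by (rule not_norm_retrieval[rotated]) (auto simp: u(1) v(1) bi)
  qed
  then show ?thesis
    by (intro exI[of _ \<phi>] exI[of _ "1 / 20"]) auto
qed

end
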